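(* Let $I$ be a nontrivial admissible ideal of $\mathbb{N}$. Let $(X,\sigma)$ be an $I$-limit space with $\Omega$ as the given collection of '$I$-convergent sequences' on $X$. If $\Gamma$ is the collection of all sequences in $X$ that are $I$-convergent with respect to the topology $\sigma$, then $\Omega\subset\Gamma$.
   Context: An ideal on a non-empty set $Y$ is a family $I\subset 2^Y$ closed under finite unions and under taking subsets; it is nontrivial if $I\neq\{\emptyset\}$ and $Y\notin I$; a nontrivial ideal is admissible if it contains all singletons. A sequence $\{x_n\}$ in a topological space is $I$-convergent to $x_0$ (and $x_0$ is an $I$-limit of it) if for every open set $U$ containing $x_0$ one has $\{n\in\mathbb{N}:x_n\notin U\}\in I$; it is $I$-convergent if it is $I$-convergent to some point. $I$-limit space: let $X$ be a non-empty set and let $\Omega$ be a class of infinite sequences in $X$, whose members are (by name) called '$I$-convergent sequences', each associated with an element of $X$ called an '$I$-limit' of the sequence (a relation; every member of $\Omega$ has at least one associated '$I$-limit', uniqueness is not assumed), such that: C(1) for every $x_0\in X$ the constant sequence $\{x_0,x_0,\ldots\}$ is in $\Omega$ with '$I$-limit' $x_0$; C(2) addition of a finite number of terms to a sequence affects neither its membership in $\Omega$ nor its '$I$-limit'; C(3) if $\{x_n\}\in\Omega$ has '$I$-limit' $x_0$, then every subsequence of it is in $\Omega$ with the same '$I$-limit' $x_0$. A subset $G\subset X$ is called open if and only if no sequence of $\Omega$ lying in $X-G$ has any '$I$-limit' in $G$. The collection $\sigma$ of these open sets is a topology on $X$, called the $I$-convergence topology, and $(X,\sigma)$ is called the $I$-limit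 space determined by $\Omega$. *)

theory Defs
  imports "HOL-Analysis.Abstract_Topology"
begin

definition ideal_on :: "'b set \<Rightarrow> 'b set set \<Rightarrow> bool" where
  "ideal_on Y I \<longleftrightarrow>
     Y \<noteq> {} \<and> I \<subseteq> Pow Y \<and>
     (\<forall>F. finite F \<and> F \<subseteq> I \<longrightarrow> \<Union>F \<in> I) \<and>
     (\<forall>A\<in>I. \<forall>B. B \<subseteq> A \<longrightarrow> B \<in> I)"

definition nontrivial_ideal_on :: "'b set \<Rightarrow> 'b set set \<Rightarrow> bool" where
  "nontrivial_ideal_on Y I \<longleftrightarrow> ideal_on Y I \<and> I \<noteq> {{}} \<and> Y \<notin> I"

definition admissible_ideal_on :: "'b set \<Rightarrow> 'b set set \<Rightarrow> bool" where
  "admissible_ideal_on Y I \<longleftrightarrow> nontrivial_ideal_on Y I \<and> (\<forall>y\<in>Y. {y} \<in> I)"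

definition I_limitin :: "'a topology \<Rightarrow> nat set set \<Rightarrow> (nat \<Rightarrow> 'a) \<Rightarrow> 'a \<Rightarrow> bool" where
  "I_limitin T I x a \<longleftrightarrow>
     a \<in> topspace T \<and> (\<forall>U. openin T U \<and> a \<in> U \<longrightarrow> {n. x n \<notin> U} \<in> I)"

definition I_convergentin :: "'a topology \<Rightarrow> nat set set \<Rightarrow> (nat \<Rightarrow> 'a) \<Rightarrow> bool" where
  "I_convergentin T I x \<longleftrightarrow> range x \<subseteq> topspace T \<and> (\<exists>a. I_limitin T I x a)"

text \<open>The sequence \<open>y\<close> arises from \<open>x\<close> by adding finitely many terms, at arbitrary positions:
  \<open>r\<close> lists the positions in \<open>y\<close> of the original terms.\<close>

definition adds_finitely_many_terms :: "(nat \<Rightarrow> 'a) \<Rightarrow> (nat \<Rightarrow> 'a) \<Rightarrow> bool" where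
  "adds_finitely_many_terms x y \<longleftrightarrow>
     (\<exists>r. strict_mono r \<and> finite (- range r) \<and> x = y \<circ> r)"

text \<open>\<open>\<Omega>\<close> is the class of sequences in \<open>X\<close> that are called I-convergent by name, and \<open>L x a\<close> says
  that \<open>a\<close> is a nominal I-limit of \<open>x\<close>. No ideal is involved at this point.\<close>

locale I_limit_class =
  fixes X :: "'a set"
    and \<Omega> :: "(nat \<Rightarrow> 'a) set"
    and L :: "(nat \<Rightarrow> 'a) \<Rightarrow> 'a \<Rightarrow> bool"
  assumes nonempty: "X \<noteq> {}"
    and seq_in: "\<And>x. x \<in> \<Omega> \<Longrightarrow> range x \<subseteq> X"
    and limit_in: "\<And>x a. L x a \<Longrightarrow> x \<in> \<Omega> \<and> a \<in> X"
    and limit_exists: "\<And>x. x \<in> \<Omega> \<Longrightarrow> \<exists>a. L x a"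
    and C1: "\<And>a. a \<in> X \<Longrightarrow> (\<lambda>n. a) \<in> \<Omega> \<and> L (\<lambda>n. a) a"
    and C2: "\<And>x y. range x \<subseteq> X \<Longrightarrow> range y \<subseteq> X \<Longrightarrow> adds_finitely_many_terms x y \<Longrightarrow>
               (y \<in> \<Omega> \<longleftrightarrow> x \<in> \<Omega>) \<and> (\<forall>a. L y a \<longleftrightarrow> L x a)"
    and C3: "\<And>x a r. x \<in> \<Omega> \<Longrightarrow> L x a \<Longrightarrow> strict_mono r \<Longrightarrow> x \<circ> r \<in> \<Omega> \<and> L (x \<circ> r) a"

definition I_limit_open ::
    "'a set \<Rightarrow> (nat \<Rightarrow> 'a) set \<Rightarrow> ((nat \<Rightarrow> 'a) \<Rightarrow> 'a \<Rightarrow> bool) \<Rightarrow> 'a set \<Rightarrow> bool" where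
  "I_limit_open X \<Omega> L G \<longleftrightarrow>
     G \<subseteq> X \<and> \<not> (\<exists>x\<in>\<Omega>. range x \<subseteq> X - G \<and> (\<exists>a\<in>G. L x a))"

definition I_convergence_topology ::
    "'a set \<Rightarrow> (nat \<Rightarrow> 'a) set \<Rightarrow> ((nat \<Rightarrow> 'a) \<Rightarrow> 'a \<Rightarrow> bool) \<Rightarrow> 'a topology" where
  "I_convergence_topology X \<Omega> L = topology (I_limit_open X \<Omega> L)"

context I_limit_class
begin

lemma istopology_I_limit_open: "istopology (I_limit_open X \<Omega> L)"
  unfolding istopology_def
proof (intro conjI allI impI)
  fix S T assume S: "I_limit_open X \<Omega> L S" and T: "I_limit_open X \<Omega> L T"
  have key: False
    if G: "I_limit_open X \<Omega> L G" and x: "x \<in> \<Omega>" "L x a" "a \<in> G"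
      and inf: "infinite {n. x n \<notin> G}" for G x a
  proof -
    let ?r = "enumerate {n. x n \<notin> G}"
    have "strict_mono ?r"
      using inf by (rule strict_mono_enumerate)
    then have "x \<circ> ?r \<in> \<Omega>" "L (x \<circ> ?r) a"
      using C3 x by blast+
    moreover have "range (x \<circ> ?r) \<subseteq> X - G"
      using seq_in[OF x(1)] enumerate_in_set[OF inf] by auto
    ultimately show False
      using G x(3) unfolding I_limit_open_def by blast
  qed
  show "I_limit_open X \<Omega> L (S \<inter> T)"
    unfolding I_limit_open_def
  proof (intro conjI notI)
    show "S \<inter> T \<subseteq> X"
      using S by (auto simp: I_limit_open_def)
    assume "\<exists>x\<in>\<Omega>. range x \<subseteq> X - S \<inter> T \<and> (\<exists>a\<in>S \<inter> T. L x a)"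
    then obtain x a where x: "x \<in> \<Omega>" "range x \<subseteq> X - S \<inter> T" "a \<in> S" "a \<in> T" "L x a"
      by blast
    have "finite {n. x n \<notin> S}" "finite {n. x n \<notin> T}"
      using key S T x by blast+
    moreover have "{n. x n \<notin> S} \<union> {n. x n \<notin> T} = UNIV"
      using x(2) by auto
    ultimately show False
      by (metis finite_Un infinite_UNIV_nat)
  qed
next
  fix K assume "\<forall>S\<in>K. I_limit_open X \<Omega> L S"
  then show "I_limit_open X \<Omega> L (\<Union>K)"
    unfolding I_limit_open_def by blast
qed

lemma openin_I_convergence_topology:
  "openin (I_convergence_topology X \<Omega> L) G \<longleftrightarrow> I_limit_open X \<Omega> L G"
  unfolding I_convergence_topology_def
  by (simp add: topology_inverse'[OF istopology_I_limit_open])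

lemma topspace_I_convergence_topology: "topspace (I_convergence_topology X \<Omega> L) = X"
proof -
  have "I_limit_open X \<Omega> L X"
    unfolding I_limit_open_def by auto
  then show ?thesis
    unfolding topspace_def openin_I_convergence_topology
    by (auto simp: I_limit_open_def)
qed

end

end

theory Submission
  imports Defs
begin

text \<open>
  If infinitely many terms of a sequence in \<open>\<Omega>\<close> lay outside an open neighbourhood of one of its
  limits, those terms would form a subsequence in the complement with a limit in the neighbourhood,
  contradicting openness. So only finitely many terms lie outside, and an admissible ideal contains
  all finite sets.
\<close>

text \<open>A finite set is the union of the finite family of its singletons; for
  \<open>A = {}\<close> that family is empty.\<close>

lemma finite_in_admissible_ideal:
  assumes "admissible_ideal_on Y I" "finite A" "A \<subseteq> Y"
  shows "A \<in> I"
proof -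
  have "finite ((\<lambda>y. {y}) ` A) \<and> (\<lambda>y. {y}) ` A \<subseteq> I"
    using assms by (auto simp: admissible_ideal_on_def)
  then have "\<Union>((\<lambda>y. {y}) ` A) \<in> I"
    using assms(1)
    unfolding admissible_ideal_on_def nontrivial_ideal_on_def ideal_on_def by blast
  then show ?thesis
    by simp
qed

lemma (in I_limit_class) finite_outside_I_limit_open:
  assumes G: "I_limit_open X \<Omega> L G" and x: "L x a" "a \<in> G"
  shows "finite {n. x n \<notin> G}"
proof (rule ccontr)
  \<comment> \<open>Lists the indices of the outside terms in increasing order; once their set is
    infinite, \<open>?r\<close> is strictly increasing and \<open>C3\<close> applies.\<close>
  let ?r = "enumerate {n. x n \<notin> G}"
  assume inf: "infinite {n. x n \<notin> G}"
  have \<Omega>: "x \<in> \<Omega>"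
    using limit_in x(1) by blast
  have "x \<circ> ?r \<in> \<Omega>" "L (x \<circ> ?r) a"
    using C3[OF \<Omega> x(1) strict_mono_enumerate[OF inf]] by blast+
  moreover have "range (x \<circ> ?r) \<subseteq> X - G"
    using seq_in[OF \<Omega>] enumerate_in_set[OF inf] by auto
  ultimately show False
    using G x(2) unfolding I_limit_open_def by blast
qed

text \<open>Provides the witness for I-convergence in \<sigma>: the nominal limit itself
  serves.\<close>

lemma (in I_limit_class) I_limitin_I_convergence_topology:
  assumes "admissible_ideal_on UNIV I" "L x a"
  shows "I_limitin (I_convergence_topology X \<Omega> L) I x a"
  unfolding I_limitin_def openin_I_convergence_topology topspace_I_convergence_topology
  using limit_in[OF assms(2)] finite_outside_I_limit_open[OF _ assms(2)]
    finite_in_admissible_ideal[OF assms(1)]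
  by blast

theorem theorem2p5:
  fixes I :: "nat set set"
    and X :: "'a set"
    and \<sigma> :: "'a topology"
    and \<Omega> \<Gamma> :: "(nat \<Rightarrow> 'a) set"
    and L :: "(nat \<Rightarrow> 'a) \<Rightarrow> 'a \<Rightarrow> bool"
  assumes "admissible_ideal_on UNIV I"
    and "I_limit_class X \<Omega> L"
    and "\<sigma> = I_convergence_topology X \<Omega> L"
    and "\<Gamma> = {x. range x \<subseteq> X \<and> I_convergentin \<sigma> I x}"
  shows "\<Omega> \<subseteq> \<Gamma>"
proof
  interpret I_limit_class X \<Omega> L by fact
  fix x assume x: "x \<in> \<Omega>"
  then obtain a where "L x a"
    using limit_exists by blast
  then have "I_limitin \<sigma> I x a"
    unfolding assms(3) by (rule I_limitin_I_convergence_topology[OF assms(1)])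
  \<comment> \<open>The range condition occurs both in \<Gamma> and in
    \<open>I_convergentin\<close>; since the topspace is \<open>X\<close>, \<open>seq_in\<close>
    settles both.\<close>
  then show "x \<in> \<Gamma>"
    using seq_in[OF x]
    by (auto simp: assms(3,4) I_convergentin_def topspace_I_convergence_topology)
qed

end
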